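(* For each even integer $n\ge 8$, the Kurepa determinant $K_n$ is not divisible by $n$, i.e. $K_n\not\equiv 0\pmod n$.
   Context: For an integer $N\ge 7$ let $m=N-4$ and let $M_N=(a_{ij})_{1\le i,j\le m}$ be the integer matrix with entries: row $1$: $a_{1j}=1$ for $1\le j\le m-1$ and $a_{1m}=3$; for $2\le i\le m-1$: $a_{ij}=0$ if $j<i-2$, $a_{i,i-2}=1$ (when $i\ge 3$), $a_{i,i-1}=i+1$, $a_{ij}=1$ for $i\le j\le m-1$, and $a_{im}=2$; last row $m$: $a_{mj}=0$ for $j\le m-2$, $a_{m,m-1}=1$, $a_{mm}=-4$. (E.g. for $N=7$: rows $(1,1,3),(3,1,2),(0,1,-4)$.) The Kurepa determinant is $K_N=\det M_N$. *)

theory Defs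
  imports "Jordan_Normal_Form.Determinant" "HOL-Number_Theory.Cong"
begin

text \<open>
  Indices are 1-based, \<open>1 \<le> i, j \<le> m\<close>. Conditions such as $j < i-2$ are written \<open>j + 2 < i\<close>
  to avoid truncated subtraction.
\<close>

definition kurepa_entry :: "nat \<Rightarrow> nat \<Rightarrow> nat \<Rightarrow> int" where
  "kurepa_entry m i j =
     (if i = 1 then (if j = m then 3 else 1)
      else if i = m then (if j + 2 \<le> m then 0 else if j + 1 = m then 1 else - 4)
      else if j + 2 < i then 0
      else if j + 2 = i then 1
      else if j + 1 = i then int i + 1
      else if j < m then 1
      else 2)"

text \<open>The constructor \<open>mat\<close> is 0-based, hence the shift of both indices.\<close>

definition kurepa_mat :: "nat \<Rightarrow> int mat" where
  "kurepa_mat N = mat (N - 4) (N - 4) (\<lambda>(i, j). kurepa_entry (N - 4) (i + 1) (j + 1))"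

lemma kurepa_mat_7:
  "kurepa_mat 7 = mat_of_rows_list 3 [[1, 1, 3], [3, 1, 2], [0, 1, - 4]]"
  by (rule eq_matI)
     (auto simp: kurepa_mat_def kurepa_entry_def mat_of_rows_list_def less_Suc_eq numeral_eq_Suc)

definition kurepa_det :: "nat \<Rightarrow> int" where
  "kurepa_det N = det (kurepa_mat N)"

end

theory Submission
  imports Defs "HOL-Library.Z2"
begin

text \<open>
  The determinant is odd. Let \<open>w\<close> be in the kernel of the matrix modulo 2 and let
  \<open>T i = w i + \<dots> + w (m - 1)\<close>. Row 2 says \<open>T 1 = 0\<close>, the last row says \<open>T (m - 1) = 0\<close>, and row
  \<open>i\<close> for \<open>3 \<le> i < m\<close> says \<open>T (i - 2) = i (T (i - 1) + T i)\<close>. For even \<open>i\<close> this gives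
  \<open>T (i - 2) = 0\<close>, and for odd \<open>i\<close> it propagates \<open>T 1 = 0\<close> to all odd indices, so that
  \<open>T = 0\<close>. Row 1 then yields \<open>w m = T 1 = 0\<close>.
\<close>

text \<open>These default rules replace \<open>+\<close> and \<open>*\<close> by bit operations, so that no ring lemma applies.\<close>

declare add_bit_eq_xor [simp del] mult_bit_eq_and [simp del]

lemma of_int_bit_eq_0_iff: "(of_int k :: bit) = 0 \<longleftrightarrow> even k"
proof -
  have "of_int (2 * l) = (0 :: bit)" "of_int (2 * l + 1) = (1 :: bit)" for l
    by simp_all
  then show ?thesis
    by (metis evenE oddE zero_neq_one)
qed

lemma of_nat_bit_parity: "(of_nat k :: bit) = (if even k then 0 else 1)"
  using of_int_bit_eq_0_iff[of "int k"] by (cases "of_nat k :: bit") simp_all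

lemma add_bit_eq_0_iff: "x + y = 0 \<longleftrightarrow> x = (y :: bit)"
  by (cases x; cases y) auto

lemma kurepa_entry_bit_first: "(of_int (kurepa_entry m 1 j) :: bit) = 1"
  by (simp add: kurepa_entry_def)

text \<open>The factor \<open>x\<close> and the three indicators let a row sum split termwise. The
  entry 2 in column \<open>m\<close> vanishes modulo 2; for \<open>i = 2\<close> the first indicator
  picks the padding column 0.\<close>

lemma kurepa_entry_bit_middle:
  assumes "2 \<le> i" "i < m" "j \<le> m"
  shows "(of_int (kurepa_entry m i j) :: bit) * x =
    (if j = i - 2 then x else 0) + (if j = i - 1 then of_nat (i + 1) * x else 0)
      + (if j \<in> {i..<m} then x else 0)"
proof -
  consider "j + 2 < i" | "i = j + 2" | "i = j + 1" | "i \<le> j" "j < m" | "j = m"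
    using assms by linarith
  then show ?thesis
    using assms by cases (simp_all add: kurepa_entry_def, linarith+)
qed

lemma kurepa_entry_bit_last:
  assumes "1 < m" "j \<le> m"
  shows "(of_int (kurepa_entry m m j) :: bit) = (if j = m - 1 then 1 else 0)"
  using assms by (auto simp: kurepa_entry_def)

lemma kurepa_kernel_bit_trivial:
  fixes w :: "nat \<Rightarrow> bit"
  assumes m: "even m" "4 \<le> m"
    and w0: "w 0 = 0"
    and rows: "\<And>i. 1 \<le> i \<Longrightarrow> i \<le> m \<Longrightarrow> (\<Sum>j\<le>m. of_int (kurepa_entry m i j) * w j) = 0"
    and j: "j \<le> m"
  shows "w j = 0"
proof -
  \<comment> \<open>The sums stop before \<open>m\<close> because column \<open>m\<close> is even in
    every row except the first.\<close>
  define T where "T i = sum w {i..<m}" for i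
  have T_step: "T i = w i + T (Suc i)" if "i < m" for i
    using that by (simp add: T_def sum.atLeast_Suc_lessThan)
  have first: "w m = T 1"
  proof -
    have "(\<Sum>j\<le>m. w j) = w 0 + T 1 + w m"
      using m by (simp add: T_def atLeast0AtMost[symmetric] sum.last_plus sum.atLeast_Suc_lessThan
        add_ac flip: atLeastLessThanSuc_atLeastAtMost)
    then show ?thesis
      using rows[of 1, unfolded kurepa_entry_bit_first] m w0 by (simp add: add_bit_eq_0_iff)
  qed
  have middle: "w (i - 2) + of_nat (i + 1) * w (i - 1) + T i = 0" if i: "2 \<le> i" "i < m" for i
  proof -
    have "0 = (\<Sum>j\<le>m. of_int (kurepa_entry m i j) * w j)"
      using rows[of i] i by simp
    also have "\<dots> = (\<Sum>j\<le>m. (if j = i - 2 then w j else 0)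
        + (if j = i - 1 then of_nat (i + 1) * w j else 0) + (if j \<in> {i..<m} then w j else 0))"
      using i by (intro sum.cong refl kurepa_entry_bit_middle) auto
    also have "\<dots> = w (i - 2) + of_nat (i + 1) * w (i - 1) + sum w ({..m} \<inter> {i..<m})"
      using i le_trans[OF diff_le_self, of i m] by (simp add: sum.distrib sum.inter_restrict)
    also have "{..m} \<inter> {i..<m} = {i..<m}"
      by auto
    finally show ?thesis
      unfolding T_def by (rule sym)
  qed
  have last: "w (m - 1) = 0"
  proof -
    have "0 = (\<Sum>j\<le>m. of_int (kurepa_entry m m j) * w j)"
      using rows[of m] m by simp
    also have "\<dots> = (\<Sum>j\<le>m. if j = m - 1 then w j else 0)"
      using m by (intro sum.cong refl) (simp add: kurepa_entry_bit_last)
    finally show ?thesis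
      by simp
  qed
  have T_last: "T (m - 1) = 0"
    using T_step[of "m - 1"] last m by (simp add: T_def)
  have T_1: "T 1 = 0"
    using middle[of 2] T_step[of 1] w0 m by (simp add: numeral_2_eq_2)
  \<comment> \<open>Row \<open>i\<close> with each \<open>w\<close> written as a sum of two
    consecutive \<open>T\<close>: the coefficient of \<open>T (i - 1)\<close> and of
    \<open>T i\<close> is \<open>i + 2\<close>, that is \<open>i\<close> modulo 2.\<close>
  have rec: "T (i - 2) = of_nat i * (T (i - 1) + T i)" if i: "3 \<le> i" "i < m" for i
  proof -
    have "T (i - 2) = w (i - 2) + T (i - 1)" "T (i - 1) = w (i - 1) + T i"
      using i T_step[of "i - 2"] T_step[of "i - 1"] by (simp_all add: numeral_2_eq_2 Suc_diff_Suc)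
    then show ?thesis
      using middle[of i] i
      by (cases "w (i - 2)"; cases "w (i - 1)"; cases "T i")
        (auto simp: of_nat_bit_parity split: if_splits)
  qed
  have T_even: "T i = 0" if "even i" "2 \<le> i" "i + 2 < m" for i
    using rec[of "i + 2"] that by (simp add: of_nat_bit_parity)
  have T_odd: "T (2 * k + 1) = 0" if "2 * k + 1 < m" for k
    using that
  proof (induction k)
    case 0
    show ?case using T_1 by simp
  next
    case (Suc k)
    show ?case
    \<comment> \<open>At \<open>m - 1\<close> the induction would need \<open>T (m - 2) = 0\<close>,
      which \<open>T_even\<close> does not reach; the last row gives the value directly.\<close>
    proof (cases "2 * Suc k + 1 = m - 1")
      case True
      then show ?thesis using T_last by simp
    next
      case False
      then have lt: "2 * Suc k + 2 < m"
        using Suc.prems m(1) by presburger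
      have "T (2 * Suc k) = 0"
        using lt by (intro T_even) auto
      then show ?thesis
        using rec[of "2 * Suc k + 1"] Suc lt by (simp add: of_nat_bit_parity)
    qed
  qed
  \<comment> \<open>Row \<open>m\<close> does not satisfy \<open>rec\<close>, so the odd row
    \<open>m - 1\<close> is used: \<open>T (m - 3) = T (m - 2) + T (m - 1)\<close>, where the outer
    two vanish.\<close>
  have T_penultimate: "T (m - 2) = 0"
  proof -
    obtain k where k: "m = 2 * k + 4"
    proof
      show "m = 2 * (m div 2 - 2) + 4"
        using m by presburger
    qed
    show ?thesis
      using rec[of "m - 1"] T_last T_odd[of k] by (simp add: k of_nat_bit_parity)
  qed
  have T_0: "T i = 0" if i: "1 \<le> i" "i \<le> m" for i
  proof (cases "even i")
    case True
    then have "i + 2 < m \<or> i = m - 2 \<or> i = m"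
      using i m by presburger
    then consider "i + 2 < m" | "i = m - 2" | "i = m"
      by blast
    then show ?thesis
      by cases (use T_even[of i] T_penultimate True i in \<open>auto simp: T_def\<close>)
  next
    case False
    then show ?thesis
      using T_odd[of "i div 2"] i m by (cases "i = m") auto
  qed
  \<comment> \<open>For \<open>1 \<le> j < m\<close>, \<open>w j\<close> is the difference of
    \<open>T j\<close> and \<open>T (Suc j)\<close>.\<close>
  consider "j = 0" | "1 \<le> j" "j < m" | "j = m"
    using j by linarith
  then show ?thesis
    by cases (use w0 T_0[of j] T_0[of "Suc j"] T_step[of j] first T_1 in auto)
qed

text \<open>Reduction modulo 2 commutes with the determinant, and over the field \<open>bit\<close>
  a zero determinant yields a nonzero kernel vector.\<close>

lemma odd_kurepa_det:
  assumes "even n" "8 \<le> n"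
  shows "odd (kurepa_det n)"
proof
  assume "even (kurepa_det n)"
  define m where "m = n - 4"
  define A :: "bit mat" where "A = map_mat of_int (kurepa_mat n)"
  have A: "A \<in> carrier_mat m m"
    by (simp add: A_def kurepa_mat_def m_def)
  have "det A = 0"
    using \<open>even (kurepa_det n)\<close>
    by (simp add: A_def kurepa_det_def of_int_bit_eq_0_iff)
  then obtain v where v: "v \<in> carrier_vec m" "v \<noteq> 0\<^sub>v m" "A *\<^sub>v v = 0\<^sub>v m"
    using det_0_iff_vec_prod_zero_field[OF A] by auto
  \<comment> \<open>Shifts the 0-based \<open>v\<close> to 1-based indices, padded with 0 at index
    0.\<close>
  define w where "w j = (if j = 0 then 0 else v $ (j - 1))" for j
  have "(\<Sum>j\<le>m. of_int (kurepa_entry m i j) * w j) = 0" if i: "1 \<le> i" "i \<le> m" for i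
  proof -
    have "0 = (A *\<^sub>v v) $ (i - 1)"
      using v(3) i by simp
    also have "\<dots> = (\<Sum>j<m. of_int (kurepa_entry m i (Suc j)) * w (Suc j))"
      using i v(1) by (simp add: A_def kurepa_mat_def m_def scalar_prod_def w_def atLeast0LessThan)
    also have "\<dots> = (\<Sum>j\<le>m. of_int (kurepa_entry m i j) * w j)"
      by (simp add: sum.atMost_shift w_def)
    finally show ?thesis
      by simp
  qed
  then have "w j = 0" if "j \<le> m" for j
    using kurepa_kernel_bit_trivial[of m w j] assms that by (auto simp: m_def w_def)
  then have "v $ j = 0" if "j < m" for j
    using that by (metis Suc_leI diff_Suc_1 nat.distinct(1) w_def)
  then have "v = 0\<^sub>v m"
    using v(1) by (intro eq_vecI) auto
  then show False
    using v(2) by simp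
qed

theorem theorem2:
  fixes n :: nat
  assumes "even n" and "n \<ge> 8"
  shows "\<not> [kurepa_det n = 0] (mod int n)"
proof
  assume "[kurepa_det n = 0] (mod int n)"
  then have "int n dvd kurepa_det n"
    by (simp add: cong_0_iff)
  then have "even (kurepa_det n)"
    using assms(1) by (meson dvd_trans even_of_nat_iff)
  then show False
    using odd_kurepa_det assms by blast
qed

end
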